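(* Let $\mathbb{C}\subset^{\varphi_0}B\subset^{\varphi_1}A_1\subset^{\varphi_2}A_2\subset^{\varphi_3}\cdots$ be a tower of amalgamated noncommutative probability spaces. For any $k<i<j$ in $\mathbb{N}$, $(A_j,E_{i,j})$ and $(A_j,E_{k,j})$ are compatible, i.e. $E_{k,j}(x)=E_{k,j}\bigl(E_{i,j}(x)\bigr)$ for all $x\in A_j$.
   Context: Algebras are unital and complex. Tower of amalgamated noncommutative probability spaces: a sequence of unital algebras $A_0=B\subset A_1\subset A_2\subset\cdots$, each a unital subalgebra of the next (common unit), a fixed linear functional $\varphi_0:B\to\mathbb{C}$, and for each $n\ge1$ a conditional expectation $\varphi_n:A_n\to A_{n-1}$, i.e. a linear map with $\varphi_n(b)=b$ and $\varphi_n(bxb')=b\varphi_n(x)b'$ for $b,b'\in A_{n-1}$, $x\in A_n$. For $1\le k\le j$, $E_{k,j}=\varphi_k\varphi_{k+1}\cdots\varphi_j:A_j\to A_{k-1}$ (composition). Compatibility: for $B_0\subset D\subset A$ (common unit) and conditional expectations $\varphi':A\to D$, $\varphi:A\to B_0$, the spaces $(A,\varphi')$ and $(A,\varphi)$ are compatible if $\varphi(x)=\varphi(\varphi'(x))$ for all $x\in A$. *)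

theory Defs
  imports "HOL-Algebra.Algebraic_Closure_Type"
begin

text \<open>
  The library locale \<open>algebra\<close> is restricted to commutative algebras, so (not necessarily
  commutative) unital complex algebras are defined here; the scalar ring is the type
  \<^typ>\<open>complex\<close> viewed as a ring record. The zero algebra is not excluded.
\<close>

abbreviation complex_ring :: "complex ring" where
  "complex_ring \<equiv> ring_of_type_algebra"

locale complex_algebra = module complex_ring A + ring A
  for A :: "(complex, 'a) module" (structure) +
  assumes smult_mult_left:
      "\<lbrakk>x \<in> carrier A; y \<in> carrier A\<rbrakk> \<Longrightarrow> (c \<odot> x) \<otimes> y = c \<odot> (x \<otimes> y)"
    and smult_mult_right:
      "\<lbrakk>x \<in> carrier A; y \<in> carrier A\<rbrakk> \<Longrightarrow> x \<otimes> (c \<odot> y) = c \<odot> (x \<otimes> y)"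

text \<open>
  The operations of \<open>D\<close> are those of \<open>A\<close>, compared on the carrier of \<open>D\<close> only;
  the inclusion need not be strict.
\<close>

definition unital_subalgebra :: "(complex, 'a) module \<Rightarrow> (complex, 'a) module \<Rightarrow> bool" where
  "unital_subalgebra D A \<longleftrightarrow>
     complex_algebra D \<and> complex_algebra A \<and>
     carrier D \<subseteq> carrier A \<and>
     \<one>\<^bsub>D\<^esub> = \<one>\<^bsub>A\<^esub> \<and> \<zero>\<^bsub>D\<^esub> = \<zero>\<^bsub>A\<^esub> \<and>
     (\<forall>x \<in> carrier D. \<forall>y \<in> carrier D. x \<oplus>\<^bsub>D\<^esub> y = x \<oplus>\<^bsub>A\<^esub> y \<and> x \<otimes>\<^bsub>D\<^esub> y = x \<otimes>\<^bsub>A\<^esub> y) \<and>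
     (\<forall>c. \<forall>x \<in> carrier D. c \<odot>\<^bsub>D\<^esub> x = c \<odot>\<^bsub>A\<^esub> x)"

definition linear_functional :: "(complex, 'a) module \<Rightarrow> ('a \<Rightarrow> complex) \<Rightarrow> bool" where
  "linear_functional A f \<longleftrightarrow>
     (\<forall>x \<in> carrier A. \<forall>y \<in> carrier A. f (x \<oplus>\<^bsub>A\<^esub> y) = f x + f y) \<and>
     (\<forall>c. \<forall>x \<in> carrier A. f (c \<odot>\<^bsub>A\<^esub> x) = c * f x)"

definition linear_map ::
  "(complex, 'a) module \<Rightarrow> (complex, 'b) module \<Rightarrow> ('a \<Rightarrow> 'b) \<Rightarrow> bool" where
  "linear_map A D f \<longleftrightarrow>
     f \<in> carrier A \<rightarrow> carrier D \<and>
     (\<forall>x \<in> carrier A. \<forall>y \<in> carrier A. f (x \<oplus>\<^bsub>A\<^esub> y) = f x \<oplus>\<^bsub>D\<^esub> f y) \<and>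
     (\<forall>c. \<forall>x \<in> carrier A. f (c \<odot>\<^bsub>A\<^esub> x) = c \<odot>\<^bsub>D\<^esub> f x)"

definition conditional_expectation ::
  "(complex, 'a) module \<Rightarrow> (complex, 'a) module \<Rightarrow> ('a \<Rightarrow> 'a) \<Rightarrow> bool" where
  "conditional_expectation A D f \<longleftrightarrow>
     unital_subalgebra D A \<and>
     linear_map A D f \<and>
     (\<forall>b \<in> carrier D. f b = b) \<and>
     (\<forall>b \<in> carrier D. \<forall>b' \<in> carrier D. \<forall>x \<in> carrier A.
        f (b \<otimes>\<^bsub>A\<^esub> x \<otimes>\<^bsub>A\<^esub> b') = b \<otimes>\<^bsub>D\<^esub> f x \<otimes>\<^bsub>D\<^esub> b')"

text \<open>
  The functional \<open>\<phi>\<^sub>0 : A\<^sub>0 \<rightarrow> \<complex>\<close> is the separate argument \<open>\<phi>0\<close>; the value \<open>\<phi> 0\<close> is never used.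
\<close>

definition ncps_tower ::
  "(nat \<Rightarrow> (complex, 'a) module) \<Rightarrow> ('a \<Rightarrow> complex) \<Rightarrow> (nat \<Rightarrow> 'a \<Rightarrow> 'a) \<Rightarrow> bool" where
  "ncps_tower A \<phi>0 \<phi> \<longleftrightarrow>
     (\<forall>n. unital_subalgebra (A n) (A (Suc n))) \<and>
     linear_functional (A 0) \<phi>0 \<and>
     (\<forall>n\<ge>1. conditional_expectation (A n) (A (n - 1)) (\<phi> n))"

text \<open>\<open>\<phi>\<^sub>k \<circ> \<phi>\<^sub>k\<^sub>+\<^sub>1 \<circ> \<dots> \<circ> \<phi>\<^sub>j\<close>, used for \<open>1 \<le> k \<le> j\<close>.\<close>

definition tower_E :: "(nat \<Rightarrow> 'a \<Rightarrow> 'a) \<Rightarrow> nat \<Rightarrow> nat \<Rightarrow> 'a \<Rightarrow> 'a" where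
  "tower_E \<phi> k j = foldr (\<circ>) (map \<phi> [k..<Suc j]) id"

text \<open>
  Compatibility of \<open>(A, \<phi>' : A \<rightarrow> D)\<close> and \<open>(A, \<phi> : A \<rightarrow> B\<^sub>0)\<close> for \<open>B\<^sub>0 \<subseteq> D \<subseteq> A\<close>. That
  the two maps are conditional expectations is part of the notion.
\<close>

definition compatible ::
  "(complex, 'a) module \<Rightarrow> (complex, 'a) module \<Rightarrow> ('a \<Rightarrow> 'a) \<Rightarrow>
   (complex, 'a) module \<Rightarrow> ('a \<Rightarrow> 'a) \<Rightarrow> bool" where
  "compatible A D \<phi>' B0 \<phi> \<longleftrightarrow>
     unital_subalgebra B0 D \<and> unital_subalgebra D A \<and>
     conditional_expectation A D \<phi>' \<and> conditional_expectation A B0 \<phi> \<and>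
     (\<forall>x \<in> carrier A. \<phi> x = \<phi> (\<phi>' x))"

end

theory Submission
  imports Defs
begin

text \<open>
  Conditional expectations compose, so every \<open>E\<^sub>k\<^sub>,\<^sub>j\<close> is one onto \<open>A\<^sub>k\<^sub>-\<^sub>1\<close>. Since
  \<open>E\<^sub>k\<^sub>,\<^sub>j = E\<^sub>k\<^sub>,\<^sub>i\<^sub>-\<^sub>1 \<circ> E\<^sub>i\<^sub>,\<^sub>j\<close> and \<open>E\<^sub>i\<^sub>,\<^sub>j\<close> is idempotent, being the identity on its range
  \<open>A\<^sub>i\<^sub>-\<^sub>1\<close>, compatibility follows.
\<close>

lemma unital_subalgebra_refl:
  "complex_algebra A \<Longrightarrow> unital_subalgebra A A"
  by (simp add: unital_subalgebra_def)

lemma unital_subalgebra_trans: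
  assumes "unital_subalgebra B D" and "unital_subalgebra D A"
  shows "unital_subalgebra B A"
  using assms unfolding unital_subalgebra_def by (simp add: subset_iff)

lemma conditional_expectation_id:
  assumes "complex_algebra A"
  shows "conditional_expectation A A id"
  using assms by (simp add: conditional_expectation_def linear_map_def unital_subalgebra_refl)

lemma linear_map_comp:
  assumes "linear_map A D f" and "linear_map D B g"
  shows "linear_map A B (g \<circ> f)"
  using assms unfolding linear_map_def by (simp add: Pi_iff)

text \<open>Factors from \<open>B\<close> already lie in \<open>D\<close>, so they pass first
  through \<open>f\<close> and then through \<open>g\<close>, which is applied to \<open>f x\<close>
  in \<open>D\<close>.\<close>

lemma conditional_expectation_comp:
  assumes f: "conditional_expectation A D f" and g: "conditional_expectation D B g"
  shows "conditional_expectation A B (g \<circ> f)"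
proof -
  have BD: "carrier B \<subseteq> carrier D"
    using g by (simp add: conditional_expectation_def unital_subalgebra_def)
  have fD: "f x \<in> carrier D" if "x \<in> carrier A" for x
    using f that by (auto simp: conditional_expectation_def linear_map_def)
  have "unital_subalgebra B A" and "linear_map A B (g \<circ> f)"
    using f g unital_subalgebra_trans linear_map_comp
    unfolding conditional_expectation_def by blast+
  then show ?thesis
    using f g BD fD unfolding conditional_expectation_def by (simp add: subset_iff)
qed

lemma conditional_expectation_idem:
  assumes "conditional_expectation A D f" and "x \<in> carrier A"
  shows "f (f x) = f x"
  using assms by (auto simp: conditional_expectation_def linear_map_def)

text \<open>\<open>foldr_append\<close> would make the right fold the start value of the left one;
  associativity turns it into a separate factor.\<close>

lemma foldr_comp_id: "foldr (\<circ>) (fs @ gs) id = foldr (\<circ>) fs id \<circ> foldr (\<circ>) gs id"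
  by (induction fs) (simp_all add: comp_assoc)

lemma tower_E_split:
  assumes "k \<le> i" and "i \<le> j"
  shows "tower_E \<phi> k j = tower_E \<phi> k i \<circ> tower_E \<phi> (Suc i) j"
proof -
  \<comment> \<open>If \<open>i = j\<close>, the second list is empty and its composition is
    \<open>id\<close>.\<close>
  have "[k..<Suc j] = [k..<Suc i] @ [Suc i..<Suc j]"
    using assms upt_add_eq_append[of k "Suc i" "j - i"] by simp
  then show ?thesis
    unfolding tower_E_def by (simp only: map_append foldr_comp_id)
qed

lemma unital_subalgebra_tower:
  assumes "ncps_tower A \<phi>0 \<phi>" and "m \<le> n"
  shows "unital_subalgebra (A m) (A n)"
  using assms(2)
proof (induction n rule: dec_induct)
  case base
  then show ?case
    using assms(1) unital_subalgebra_refl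
    unfolding ncps_tower_def unital_subalgebra_def by blast
next
  case (step n)
  then show ?case
    using assms(1) unital_subalgebra_trans unfolding ncps_tower_def by blast
qed

text \<open>Indexing by the target \<open>m\<close> instead of \<open>k = m + 1\<close> lets the
  induction on \<open>j\<close> start at \<open>j = m\<close>, where the composition is empty and
  hence \<open>id\<close>.\<close>

lemma conditional_expectation_tower_E:
  assumes tower: "ncps_tower A \<phi>0 \<phi>" and "m \<le> j"
  shows "conditional_expectation (A j) (A m) (tower_E \<phi> (Suc m) j)"
  using assms(2)
proof (induction j rule: dec_induct)
  case base
  have "complex_algebra (A m)"
    using tower by (simp add: ncps_tower_def unital_subalgebra_def)
  then show ?case
    using conditional_expectation_id by (simp add: tower_E_def flip: id_def)
next
  case (step j)
  have "conditional_expectation (A (Suc j)) (A j) (\<phi> (Suc j))"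
    using tower unfolding ncps_tower_def
    by (metis diff_Suc_1 le_add1 plus_1_eq_Suc)
  \<comment> \<open>The new map acts first, leading down into \<open>A j\<close>, where the
    induction hypothesis takes over.\<close>
  moreover have "tower_E \<phi> (Suc m) (Suc j) = tower_E \<phi> (Suc m) j \<circ> \<phi> (Suc j)"
    using \<open>m \<le> j\<close> by (simp add: tower_E_def foldr_comp_id del: foldr_append)
  ultimately show ?case
    using conditional_expectation_comp step.IH by metis
qed

theorem theorem3p2:
  fixes A :: "nat \<Rightarrow> (complex, 'a) module"
    and \<phi>0 :: "'a \<Rightarrow> complex"
    and \<phi> :: "nat \<Rightarrow> 'a \<Rightarrow> 'a"
    and i j k :: nat
  assumes "ncps_tower A \<phi>0 \<phi>"
    and "1 \<le> k" and "k < i" and "i < j"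
  shows "compatible (A j) (A (i - 1)) (tower_E \<phi> i j) (A (k - 1)) (tower_E \<phi> k j)"
proof -
  \<comment> \<open>Since \<open>1 \<le> k\<close> and \<open>k < i\<close>, both
    \<open>Suc (i - 1) = i\<close> and \<open>Suc (k - 1) = k\<close> hold.\<close>
  have Ei: "conditional_expectation (A j) (A (i - 1)) (tower_E \<phi> i j)"
    using conditional_expectation_tower_E[OF assms(1), of "i - 1" j] assms by simp
  have Ek: "conditional_expectation (A j) (A (k - 1)) (tower_E \<phi> k j)"
    using conditional_expectation_tower_E[OF assms(1), of "k - 1" j] assms by simp
  \<comment> \<open>The split at \<open>i - 1\<close>, allowed by \<open>k < i\<close>, makes
    \<open>tower_E \<phi> i j\<close> the innermost factor, so a second copy of it is absorbed by
    idempotence.\<close>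
  have "tower_E \<phi> k j = tower_E \<phi> k (i - 1) \<circ> tower_E \<phi> i j"
    using tower_E_split[of k "i - 1" j \<phi>] assms by simp
  then have "tower_E \<phi> k j x = tower_E \<phi> k j (tower_E \<phi> i j x)" if "x \<in> carrier (A j)" for x
    using conditional_expectation_idem[OF Ei that] by simp
  moreover have "unital_subalgebra (A (k - 1)) (A (i - 1))"
    and "unital_subalgebra (A (i - 1)) (A j)"
    using unital_subalgebra_tower[OF assms(1)] assms by simp_all
  ultimately show ?thesis
    using Ei Ek by (simp add: compatible_def)
qed

end
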